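(* Let $X$ be a set with a symmetric distance function $d$ to a set of distances $D$, let $d$ be $K$-surjective, and let $E \subseteq X$. Let $G$ be a weighted tree with edge weights in $D$. If $|E| \geq 2\sigma(G)K$, then there is at least one embedding of $G$ into $E$.
   Context: A symmetric distance function from a set $X$ to a set $D$ of possible distances is a function $d: X\times X \to D$ with $d(x_1,x_2)=d(x_2,x_1)$ for all $x_1,x_2\in X$. Such a function is $K$-surjective if for every $S \subseteq X$ with $|S| \geq K$, the restriction of $d$ to $S \times S$ is surjective onto $D$. For a weighted graph $G$ with edge weights in $D$, an embedding of $G$ into a subset $E\subseteq X$ is an injective function $f: V(G)\to E$ such that for every edge $(v_1,v_2)$ of $G$ with weight $t$ one has $d(f(v_1),f(v_2))=t$. For a finite nonempty connected graph $G$ whose vertices have degrees $d_1 \geq d_2 \geq \dots \geq d_m$, the stringiness of $G$ is $\sigma(G) = (d_1 + 1)\prod_{i=2}^{m} d_i$.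
   Formalization: Adds K ≥ 1 and: in any S in X with |S| ≥ K and at least 2 points, an edge weight equal to some d(x,x), x in S, also occurs between distinct points of S. Otherwise false: discrete metric on an infinite set, D={0,1}, K=2, one edge of weight 0; K=0 fails for X empty. *)

theory Defs
  imports Complex_Main "HOL-Library.Multiset"
begin

(* |S| \<ge> r, where an infinite S exceeds every real bound (card would be 0 there). *)
definition card_at_least :: "'a set \<Rightarrow> real \<Rightarrow> bool" where
  "card_at_least S r \<longleftrightarrow> infinite S \<or> r \<le> real (card S)"

definition symmetric_distance :: "'a set \<Rightarrow> 'd set \<Rightarrow> ('a \<Rightarrow> 'a \<Rightarrow> 'd) \<Rightarrow> bool" where
  "symmetric_distance X D d \<longleftrightarrow>
     (\<forall>x\<in>X. \<forall>y\<in>X. d x y \<in> D) \<and> (\<forall>x\<in>X. \<forall>y\<in>X. d x y = d y x)"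

definition K_surjective :: "'a set \<Rightarrow> 'd set \<Rightarrow> ('a \<Rightarrow> 'a \<Rightarrow> 'd) \<Rightarrow> real \<Rightarrow> bool" where
  "K_surjective X D d K \<longleftrightarrow>
     (\<forall>S. S \<subseteq> X \<and> card_at_least S K \<longrightarrow> (\<lambda>(x, y). d x y) ` (S \<times> S) = D)"

(* Surjectivity of d on S \<times> S also counts the pairs (x, x), whereas the ends of an edge are
   embedded at distinct points.  The condition below says that a distance in T which occurs as
   some d x x in a large set S also occurs between two distinct points of S.  It is vacuous if no
   d x x lies in T, for instance for a metric and a set T of nonzero distances.  Without it, the
   discrete metric on an infinite set, with distances {0, 1}, is 2-surjective, but an edge of
   weight 0 has no embedding.  The bound 2 matters only for K \<le> 1, where S may be a singleton. *)
definition realised_off_diagonal :: "'a set \<Rightarrow> ('a \<Rightarrow> 'a \<Rightarrow> 'd) \<Rightarrow> real \<Rightarrow> 'd set \<Rightarrow> bool" where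
  "realised_off_diagonal X d K T \<longleftrightarrow>
     (\<forall>S. S \<subseteq> X \<and> card_at_least S K \<and> card_at_least S 2 \<longrightarrow>
        (\<forall>x\<in>S. d x x \<in> T \<longrightarrow> (\<exists>y\<in>S. \<exists>z\<in>S. y \<noteq> z \<and> d y z = d x x)))"

(* Graphs are finite, undirected and simple: a vertex set V and a set A of two-element edges. *)
definition finite_simple_graph :: "'v set \<Rightarrow> 'v set set \<Rightarrow> bool" where
  "finite_simple_graph V A \<longleftrightarrow> finite V \<and> (\<forall>e\<in>A. e \<subseteq> V \<and> card e = 2)"

definition connected_graph :: "'v set \<Rightarrow> 'v set set \<Rightarrow> bool" where
  "connected_graph V A \<longleftrightarrow>
     V \<noteq> {} \<and> (\<forall>u\<in>V. \<forall>v\<in>V. (u, v) \<in> {(x, y). {x, y} \<in> A}\<^sup>*)"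

definition graph_cycle :: "'v set set \<Rightarrow> 'v list \<Rightarrow> bool" where
  "graph_cycle A p \<longleftrightarrow> length p \<ge> 3 \<and> distinct p \<and>
     successively (\<lambda>x y. {x, y} \<in> A) p \<and> {last p, hd p} \<in> A"

definition tree_graph :: "'v set \<Rightarrow> 'v set set \<Rightarrow> bool" where
  "tree_graph V A \<longleftrightarrow>
     finite_simple_graph V A \<and> connected_graph V A \<and> (\<nexists>p. graph_cycle A p)"

definition weighted_tree :: "'v set \<Rightarrow> 'v set set \<Rightarrow> ('v set \<Rightarrow> 'd) \<Rightarrow> 'd set \<Rightarrow> bool" where
  "weighted_tree V A w D \<longleftrightarrow> tree_graph V A \<and> (\<forall>e\<in>A. w e \<in> D)"

definition vertex_degree :: "'v set set \<Rightarrow> 'v \<Rightarrow> nat" where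
  "vertex_degree A v = card {e \<in> A. v \<in> e}"

definition degree_sequence :: "'v set \<Rightarrow> 'v set set \<Rightarrow> nat list" where
  "degree_sequence V A =
     rev (sorted_list_of_multiset (image_mset (vertex_degree A) (mset_set V)))"

(* The degree sequence is in decreasing order, so hd is the largest degree; V must be finite and
   nonempty. *)
definition stringiness :: "'v set \<Rightarrow> 'v set set \<Rightarrow> nat" where
  "stringiness V A =
     (hd (degree_sequence V A) + 1) * prod_list (tl (degree_sequence V A))"

definition graph_embedding ::
    "'v set \<Rightarrow> 'v set set \<Rightarrow> ('v set \<Rightarrow> 'd) \<Rightarrow> ('a \<Rightarrow> 'a \<Rightarrow> 'd) \<Rightarrow> 'a set \<Rightarrow> ('v \<Rightarrow> 'a) \<Rightarrow> bool" where
  "graph_embedding V A w d E f \<longleftrightarrow>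
     f ` V \<subseteq> E \<and> inj_on f V \<and> (\<forall>u v. {u, v} \<in> A \<longrightarrow> d (f u) (f v) = w {u, v})"

end

(* Let \<alpha> = \<lfloor>K\<rfloor>: a set in which a weight t of the tree does not occur has at most \<alpha> elements.  Taking a
   maximal such subset, at most r * \<alpha> points of a finite set E have fewer than r neighbours in E at
   distance t.  Hence the star at a vertex c of maximal degree k embeds once |E| > k * \<alpha>: different
   weights give disjoint neighbourhoods, so the losses just add up.  The other vertices are attached
   one leaf at a time.  To attach a leaf to an embedded subtree W, delete from E the images of the
   attaching vertex; the rest contains no copy of W and is small, so some image has at least |W|
   neighbours of the required weight, one of which is unused.  This costs |W| * \<alpha> points, and
   k + (\<Sum>j = k + 1..<|V|. j) is less than twice the stringiness, because the other degrees d_i satisfy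
   \<Sum>(d_i - 1) \<ge> |V| - 1 - k with d_i \<le> k. *)
theory Submission
  imports Defs
begin

section \<open>Stars and leaves in a set where every large subset realises every weight\<close>

text \<open>Isolates what the embedding uses of surjectivity: in the graph joining points at
  distance \<open>t\<close>, independent sets have at most \<open>\<alpha>\<close> points. An
  integer bound lets all costs be counted in naturals.\<close>

locale bounded_independence =
  fixes X :: "'a set" and d :: "'a \<Rightarrow> 'a \<Rightarrow> 'd" and T :: "'d set" and \<alpha> :: nat
  assumes dist_sym: "x \<in> X \<Longrightarrow> y \<in> X \<Longrightarrow> d x y = d y x"
    and ex_dist: "t \<in> T \<Longrightarrow> S \<subseteq> X \<Longrightarrow> finite S \<Longrightarrow> \<alpha> < card S \<Longrightarrow>
      \<exists>x\<in>S. \<exists>y\<in>S. x \<noteq> y \<and> d x y = t"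
begin

definition nbrs :: "'a set \<Rightarrow> 'd \<Rightarrow> 'a \<Rightarrow> 'a set" where
  "nbrs E t x = {y \<in> E. y \<noteq> x \<and> d x y = t}"

lemma finite_nbrs: "finite E \<Longrightarrow> finite (nbrs E t x)"
  by (simp add: nbrs_def)

text \<open>A maximal subset \<open>I\<close> of the low-degree points without a pair at distance
  \<open>t\<close> dominates them all. It has at most \<open>\<alpha>\<close> points, and each
  covers at most \<open>r\<close> points: itself and fewer than \<open>r\<close> neighbours.\<close>

lemma card_low_degree_le:
  assumes "t \<in> T" "E \<subseteq> X" "finite E"
  shows "card {x \<in> E. card (nbrs E t x) < r} \<le> r * \<alpha>"
proof -
  define B where "B = {x \<in> E. card (nbrs E t x) < r}"
  define indep where "indep I \<longleftrightarrow> (\<forall>x\<in>I. \<forall>y\<in>I. x \<noteq> y \<longrightarrow> d x y \<noteq> t)" for I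
  have B: "finite B" "B \<subseteq> X" using assms by (auto simp: B_def)
  define F where "F = {I. I \<subseteq> B \<and> indep I}"
  have "finite F" using B by (simp add: F_def)
  moreover have "{} \<in> F" by (simp add: F_def indep_def)
  ultimately obtain I where IF: "I \<in> F" and maxF: "\<forall>J\<in>F. I \<subseteq> J \<longrightarrow> I = J"
    using finite_has_maximal[of F] by (metis empty_iff)
  have I: "I \<subseteq> B" "indep I" using IF by (simp_all add: F_def)
  have finI: "finite I" and IX: "I \<subseteq> X" using I B finite_subset by blast+
  have cardI: "card I \<le> \<alpha>"
    using ex_dist[OF assms(1) IX finI] I(2) unfolding indep_def by (meson not_le)
  have "B \<subseteq> (\<Union>i\<in>I. insert i (nbrs E t i))"
  proof
    fix x assume x: "x \<in> B"
    show "x \<in> (\<Union>i\<in>I. insert i (nbrs E t i))"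
    proof (rule ccontr)
      assume n: "\<not> ?thesis"
      have xE: "x \<in> E" using x by (simp add: B_def)
      \<comment> \<open>\<open>indep\<close> ranges over ordered pairs, while \<open>nbrs\<close>
        only excludes \<open>d i x = t\<close>; symmetry gives the other order.\<close>
      have "d i x \<noteq> t" "d x i \<noteq> t" if "i \<in> I" for i
        using n that xE dist_sym[of i x] IX assms(2) by (auto simp: nbrs_def)
      hence "indep (insert x I)" using I(2) by (auto simp: indep_def)
      hence "insert x I \<in> F" using x I(1) by (simp add: F_def)
      hence "x \<in> I" using maxF by blast
      thus False using n by auto
    qed
  qed
  hence "card B \<le> card (\<Union>i\<in>I. insert i (nbrs E t i))"
    using finI finite_nbrs[OF assms(3)] by (intro card_mono) auto
  also have "\<dots> \<le> (\<Sum>i\<in>I. card (insert i (nbrs E t i)))" by (rule card_UN_le[OF finI])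
  also have "\<dots> \<le> (\<Sum>i\<in>I. r)"
  proof (rule sum_mono)
    fix i assume "i \<in> I"
    hence "card (nbrs E t i) < r" using I(1) by (auto simp: B_def)
    thus "card (insert i (nbrs E t i)) \<le> r"
      using card_insert_le_m1[of r "nbrs E t i" i] by simp
  qed
  also have "\<dots> \<le> r * \<alpha>" using cardI by simp
  finally show ?thesis by (simp add: B_def)
qed

text \<open>A centre \<open>x\<close> works once, for each weight \<open>s\<close>, it has as many
  neighbours at distance \<open>s\<close> as there are leaves of weight \<open>s\<close>. The
  failing centres number at most \<open>card (M s) * \<alpha>\<close> for each \<open>s\<close>, and
  the classes \<open>M s\<close> partition \<open>N\<close>.\<close>

lemma ex_star_embedding:
  assumes A: "\<And>e. e \<in> A \<Longrightarrow> card e = 2 \<and> c \<in> e \<and> w e \<in> T"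
    and N: "N = {v. {c, v} \<in> A}" "finite N"
    and E: "E \<subseteq> X" "finite E" "card N * \<alpha> < card E"
  shows "\<exists>f. graph_embedding (insert c N) A w d E f"
proof -
  define t where "t v = w {c, v}" for v
  define M where "M s = {v \<in> N. t v = s}" for s
  have tT: "t v \<in> T" if "v \<in> N" for v using that A by (simp add: t_def N)
  have cN: "c \<notin> N" using A[of "{c}"] by (auto simp: N)
  define Bad where "Bad s = {x \<in> E. card (nbrs E s x) < card (M s)}" for s
  have "card (\<Union>s\<in>t ` N. Bad s) \<le> (\<Sum>s\<in>t ` N. card (Bad s))"
    using N(2) by (intro card_UN_le) simp
  also have "\<dots> \<le> (\<Sum>s\<in>t ` N. card (M s) * \<alpha>)"
    unfolding Bad_def by (rule sum_mono) (use tT E card_low_degree_le in blast)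
  also have "\<dots> = (\<Sum>s\<in>t ` N. card (M s)) * \<alpha>" by (simp add: sum_distrib_right)
  also have "(\<Sum>s\<in>t ` N. card (M s)) = card N"
    using sum.image_gen[OF N(2), of "\<lambda>_. 1::nat" t] by (simp add: M_def)
  finally have "card (\<Union>s\<in>t ` N. Bad s) < card E" using E(3) by simp
  moreover have "finite (\<Union>s\<in>t ` N. Bad s)" using N(2) E(2) by (auto simp: Bad_def)
  ultimately obtain x where x: "x \<in> E" "x \<notin> (\<Union>s\<in>t ` N. Bad s)"
    by (metis card_mono not_le subsetI)
  have "\<exists>g. inj_on g (M s) \<and> g ` M s \<subseteq> nbrs E s x" if "s \<in> t ` N" for s
  proof -
    have "card (M s) \<le> card (nbrs E s x)" using x that by (auto simp: Bad_def not_less)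
    moreover have "finite (M s)" using N(2) by (simp add: M_def)
    ultimately show ?thesis using card_le_inj[of "M s" "nbrs E s x"] finite_nbrs[OF E(2)] by blast
  qed
  then obtain g where g: "\<And>s. s \<in> t ` N \<Longrightarrow> inj_on (g s) (M s)"
    "\<And>s. s \<in> t ` N \<Longrightarrow> g s ` M s \<subseteq> nbrs E s x" by metis
  define f where "f v = (if v = c then x else g (t v) v)" for v
  have fn: "f v \<in> nbrs E (t v) x" if "v \<in> N" for v
    using g(2)[of "t v"] that cN by (auto simp: f_def M_def)
  have "inj_on f (insert c N)"
  proof (rule inj_onI)
    fix u v assume uv: "u \<in> insert c N" "v \<in> insert c N" "f u = f v"
    show "u = v"
    proof (cases "u = c \<or> v = c")
      case True
      thus ?thesis using uv fn[of u] fn[of v] by (auto simp: nbrs_def f_def split: if_splits)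
    next
      case False
      hence N': "u \<in> N" "v \<in> N" using uv by auto
      \<comment> \<open>A point of \<open>E\<close> has a single distance to \<open>x\<close>, so
        leaves of different weights cannot collide.\<close>
      hence "t u = t v" using fn[of u] fn[of v] uv(3) by (auto simp: nbrs_def)
      thus ?thesis using g(1)[of "t u"] N' uv(3) False
        by (auto simp: f_def M_def inj_on_def)
    qed
  qed
  moreover have "f ` insert c N \<subseteq> E"
  proof -
    have "f v \<in> E" if "v \<in> N" for v using fn[OF that] by (simp add: nbrs_def)
    thus ?thesis using x(1) by (auto simp: f_def[of c])
  qed
  moreover have "d (f u) (f v) = w {u, v}" if uv: "{u, v} \<in> A" for u v
  proof -
    \<comment> \<open>An edge is an unordered pair, so both orientations have to be checked.\<close>
    have *: "d (f c) (f v) = w {c, v}" "d (f v) (f c) = w {c, v}" if "{c, v} \<in> A" for v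
    proof -
      have "v \<in> N" using that by (simp add: N)
      from fn[OF this] show "d (f c) (f v) = w {c, v}"
        by (simp add: f_def[of c] nbrs_def t_def)
      moreover have "f v \<in> X" "f c \<in> X" using fn[OF \<open>v \<in> N\<close>] E(1) x(1)
        by (auto simp: nbrs_def f_def[of c])
      ultimately show "d (f v) (f c) = w {c, v}" using dist_sym by metis
    qed
    show ?thesis using A[OF uv] *[of u] *[of v] uv by (auto simp: insert_commute)
  qed
  ultimately show ?thesis unfolding graph_embedding_def by blast
qed

text \<open>\<open>S\<close> collects all images of \<open>u\<close>, so a copy of \<open>W\<close>
  inside \<open>E - S\<close> would be contradictory and \<open>E - S\<close> has at most
  \<open>n\<close> points. Some \<open>x\<close> in \<open>S\<close> therefore also avoids the
  low-degree points, which number at most \<open>card W * \<alpha>\<close>.\<close>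

lemma ex_embedding_insert_leaf:
  assumes emb: "\<And>E. E \<subseteq> X \<Longrightarrow> finite E \<Longrightarrow> n < card E \<Longrightarrow> \<exists>f. graph_embedding W A w d E f"
    and W: "finite W" "u \<in> W" "v \<notin> W"
    and A: "\<And>e. e \<in> A \<Longrightarrow> e \<subseteq> W" "w {u, v} \<in> T"
    and E: "E \<subseteq> X" "finite E" "n + card W * \<alpha> < card E"
  shows "\<exists>f. graph_embedding (insert v W) (insert {u, v} A) w d E f"
proof -
  define S where "S = {f u |f. graph_embedding W A w d E f}"
  define Bad where "Bad = {x \<in> E. card (nbrs E (w {u, v}) x) < card W}"
  have "\<not> (\<exists>f. graph_embedding W A w d (E - S) f)"
  proof
    assume "\<exists>f. graph_embedding W A w d (E - S) f"
    then obtain f where f: "graph_embedding W A w d (E - S) f" by blast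
    hence "graph_embedding W A w d E f" by (auto simp: graph_embedding_def)
    hence "f u \<in> S" by (auto simp: S_def)
    thus False using f W(2) by (auto simp: graph_embedding_def)
  qed
  hence "card (E - S) \<le> n" using emb[of "E - S"] E by (meson Diff_subset finite_Diff not_le order_trans)
  moreover have "card Bad \<le> card W * \<alpha>"
    unfolding Bad_def by (rule card_low_degree_le[OF A(2) E(1,2)])
  ultimately have "card ((E - S) \<union> Bad) < card E"
    using card_Un_le[of "E - S" Bad] E(3) by linarith
  moreover have "finite ((E - S) \<union> Bad)" using E(2) by (simp add: Bad_def)
  ultimately obtain x where x: "x \<in> E" "x \<notin> (E - S) \<union> Bad"
    by (metis card_mono not_le subsetI)
  then obtain f where f: "graph_embedding W A w d E f" "f u = x" by (auto simp: S_def)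
  \<comment> \<open>\<open>x\<close> is itself an image and is not its own neighbour, so at most
    \<open>card W - 1\<close> neighbours are taken and \<open>card W\<close> of them
    suffice.\<close>
  have "card (f ` W - {x}) < card W"
    using W(1,2) f(2) by (metis card_Diff1_less card_image_le finite_imageI imageI less_le_trans)
  also have "card W \<le> card (nbrs E (w {u, v}) x)" using x by (simp add: Bad_def)
  finally obtain y where y: "y \<in> nbrs E (w {u, v}) x" "y \<notin> f ` W - {x}"
    using W(1) by (metis card_mono finite_Diff finite_imageI not_le subsetI)
  hence y': "y \<in> E" "y \<notin> f ` W" "d x y = w {u, v}" by (auto simp: nbrs_def)
  have "x \<in> X" "y \<in> X" using y'(1) x(1) E(1) by auto
  hence yx: "d y x = w {u, v}" using y'(3) dist_sym by metis
  let ?f = "f(v := y)"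
  have "?f ` insert v W \<subseteq> E" using f y' W(3) by (auto simp: graph_embedding_def)
  moreover have "inj_on ?f (insert v W)"
    using f y' W(3) by (auto simp: graph_embedding_def inj_on_def)
  moreover have "d (?f a) (?f b) = w {a, b}" if ab: "{a, b} \<in> insert {u, v} A" for a b
  proof (cases "{a, b} \<in> A")
    case True
    hence "a \<noteq> v" "b \<noteq> v" using A(1) W(3) by blast+
    thus ?thesis using f(1) True by (simp add: graph_embedding_def)
  next
    case False
    hence "a = u \<and> b = v \<or> a = v \<and> b = u" using ab by (auto simp: doubleton_eq_iff)
    moreover have "u \<noteq> v" using W by auto
    ultimately show ?thesis using f(2) y' yx by (auto simp: insert_commute)
  qed
  ultimately show ?thesis unfolding graph_embedding_def by blast
qed

end

section \<open>Paths, acyclicity and growing connected subgraphs\<close>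

lemma rtrancl_imp_distinct_path:
  assumes "(x, y) \<in> {(a, b). R a b}\<^sup>*"
  shows "\<exists>p. p \<noteq> [] \<and> distinct p \<and> successively R p \<and> hd p = x \<and> last p = y"
  using assms
proof (induction rule: converse_rtrancl_induct)
  case base
  show ?case by (rule exI[of _ "[y]"]) simp
next
  case (step x z)
  then obtain p where p: "p \<noteq> []" "distinct p" "successively R p" "hd p = z" "last p = y"
    by blast
  show ?case
  proof (cases "x \<in> set p")
    \<comment> \<open>The loop is cut off: only the part of the path from \<open>x\<close> onwards
      is kept.\<close>
    case True
    then obtain q r where "p = q @ x # r" by (auto dest: split_list)
    thus ?thesis using p by (intro exI[of _ "x # r"]) (auto simp: successively_append_iff)
  next
    case False
    thus ?thesis using p step(1)
      by (intro exI[of _ "x # p"]) (auto simp: successively_Cons)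
  qed
qed

abbreviation induced_edges :: "'v set set \<Rightarrow> 'v set \<Rightarrow> 'v set set" where
  "induced_edges A W \<equiv> {e \<in> A. e \<subseteq> W}"

text \<open>A path inside \<open>W\<close> between two neighbours of \<open>v\<close> would close to
  a cycle through \<open>v\<close>. Hence a vertex added to a connected part of a tree brings only
  one edge.\<close>

lemma acyclic_unique_neighbour:
  assumes "\<nexists>p. graph_cycle A p" "connected_graph W (induced_edges A W)"
    and "v \<notin> W" "u \<in> W" "u' \<in> W" "{u, v} \<in> A" "{u', v} \<in> A"
  shows "u = u'"
proof (rule ccontr)
  assume ne: "u \<noteq> u'"
  have "(u, u') \<in> {(x, y). {x, y} \<in> induced_edges A W}\<^sup>*"
    using assms(2,4,5) by (auto simp: connected_graph_def)
  from rtrancl_imp_distinct_path[OF this] obtain p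
    where p: "p \<noteq> []" "distinct p" "successively (\<lambda>x y. {x, y} \<in> induced_edges A W) p"
      "hd p = u" "last p = u'" by blast
  \<comment> \<open>Two distinct ends force at least two vertices, so the cycle has length at least
    3 and each path vertex lies on an edge inside \<open>W\<close>.\<close>
  obtain a b q where pq: "p = a # b # q"
    using p ne by (cases p; cases "tl p") auto
  have "set p \<subseteq> W" using p(3) unfolding pq
    by (induction q arbitrary: a b) auto
  hence "graph_cycle A (v # p)"
    unfolding graph_cycle_def using p pq assms successively_mono[OF p(3), of "\<lambda>x y. {x, y} \<in> A"]
    by (auto simp: successively_Cons insert_commute)
  thus False using assms(1) by blast
qed

lemma connected_graph_insert:
  assumes "connected_graph W (induced_edges A W)" "u \<in> W" "{u, v} \<in> A"
  shows "connected_graph (insert v W) (induced_edges A (insert v W))"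
proof -
  let ?R = "\<lambda>W. {(x, y). {x, y} \<in> induced_edges A W}"
  have "?R W \<subseteq> ?R (insert v W)" by auto
  hence mono: "(?R W)\<^sup>* \<subseteq> (?R (insert v W))\<^sup>*" by (rule rtrancl_mono)
  have W: "(x, y) \<in> (?R (insert v W))\<^sup>*" if "x \<in> W" "y \<in> W" for x y
    using that assms(1) mono unfolding connected_graph_def by blast
  have uv: "(u, v) \<in> ?R (insert v W)" "(v, u) \<in> ?R (insert v W)"
    using assms by (auto simp: insert_commute)
  have "(x, v) \<in> (?R (insert v W))\<^sup>*" "(v, x) \<in> (?R (insert v W))\<^sup>*" if "x \<in> W" for x
    using W[OF that assms(2)] W[OF assms(2) that] uv
    by (meson rtrancl.rtrancl_into_rtrancl converse_rtrancl_into_rtrancl)+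
  thus ?thesis using W unfolding connected_graph_def by blast
qed

text \<open>A walk from \<open>W\<close> to a vertex outside leaves \<open>W\<close> along some
  edge, whose outer end is added next. The arbitrary start \<open>W\<^sub>0\<close> serves both a
  single vertex and a closed star.\<close>

lemma connected_graph_induct [consumes 4, case_names start insert]:
  assumes "finite V" "connected_graph V A" "W\<^sub>0 \<subseteq> V" "W\<^sub>0 \<noteq> {}" "P W\<^sub>0"
    and step: "\<And>W u v. W\<^sub>0 \<subseteq> W \<Longrightarrow> W \<subseteq> V \<Longrightarrow> u \<in> W \<Longrightarrow> v \<in> V \<Longrightarrow> v \<notin> W \<Longrightarrow> {u, v} \<in> A \<Longrightarrow> P W
      \<Longrightarrow> P (insert v W)"
    and edges: "\<And>e. e \<in> A \<Longrightarrow> e \<subseteq> V"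
  shows "P V"
proof -
  have "P V" if "W\<^sub>0 \<subseteq> W" "W \<subseteq> V" "P W" for W
    using that
  proof (induction "card (V - W)" arbitrary: W rule: less_induct)
    case less
    show ?case
    proof (cases "W = V")
      case False
      then obtain z where z: "z \<in> V" "z \<notin> W" using less.prems by auto
      obtain a where a: "a \<in> W" using less.prems assms(4) by auto
      have "(a, z) \<in> {(x, y). {x, y} \<in> A}\<^sup>*"
        using a z less.prems assms(2) by (auto simp: connected_graph_def)
      hence "\<exists>u v. u \<in> W \<and> v \<notin> W \<and> {u, v} \<in> A"
        using a z(2) by (induction rule: converse_rtrancl_induct) auto
      then obtain u v where uv: "u \<in> W" "v \<notin> W" "{u, v} \<in> A" by blast
      have v: "v \<in> V" using edges uv by auto
      have "card (V - insert v W) < card (V - W)"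
        using v uv assms(1) by (intro psubset_card_mono) auto
      thus ?thesis
        using less.hyps[of "insert v W"] step[OF less.prems(1,2) uv(1) v uv(2,3) less.prems(3)]
          less.prems v by auto
    qed (use less in simp)
  qed
  thus ?thesis using assms by blast
qed

section \<open>Counting edges and degrees\<close>

text \<open>Each vertex added to a connected part brings at least one new edge.\<close>

lemma connected_graph_card_edges:
  assumes "finite_simple_graph V A" "connected_graph V A"
  shows "card V \<le> card A + 1"
proof -
  have fin: "finite V" "finite A" "\<And>e. e \<in> A \<Longrightarrow> e \<subseteq> V"
    using assms(1) finite_subset[of A "Pow V"] by (auto simp: finite_simple_graph_def)
  obtain c where c: "{c} \<subseteq> V" using assms(2) by (auto simp: connected_graph_def)
  \<comment> \<open>Finiteness is carried along so that \<open>card (insert v W)\<close> can be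
    evaluated in the induction step.\<close>
  have "finite V \<and> card V \<le> card (induced_edges A V) + 1"
    using fin(1) assms(2) c insert_not_empty
  proof (induction rule: connected_graph_induct)
    case (insert W u v)
    have "insert {u, v} (induced_edges A W) \<subseteq> induced_edges A (insert v W)"
      using insert by auto
    hence "card (insert {u, v} (induced_edges A W)) \<le> card (induced_edges A (insert v W))"
      using fin(2) by (intro card_mono) auto
    moreover have "card (insert {u, v} (induced_edges A W)) = card (induced_edges A W) + 1"
      using fin(2) insert by (subst card_insert_disjoint) auto
    ultimately show ?case using insert by simp
  qed (use fin in auto)
  also have "induced_edges A V = A" using fin by auto
  finally show ?thesis by simp
qed

text \<open>The handshake lemma, by double counting of incidences.\<close>

lemma sum_vertex_degree:
  assumes "finite_simple_graph V A"
  shows "(\<Sum>v\<in>V. vertex_degree A v) = 2 * card A"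
proof -
  have fin: "finite V" "finite A" "\<And>e. e \<in> A \<Longrightarrow> e \<subseteq> V \<and> card e = 2"
    using assms finite_subset[of A "Pow V"] by (auto simp: finite_simple_graph_def)
  have "card {v \<in> V. v \<in> e} = 2" if "e \<in> A" for e
  proof -
    have "{v \<in> V. v \<in> e} = e" using fin(3)[OF that] by blast
    thus ?thesis using fin(3)[OF that] by simp
  qed
  thus ?thesis
    using sum_multicount[OF fin(1,2), of "\<lambda>v e. v \<in> e" 2] by (simp add: vertex_degree_def)
qed

lemma vertex_degree_eq_card_neighbours:
  assumes "finite_simple_graph V A"
  shows "vertex_degree A c = card {v. {c, v} \<in> A}"
proof -
  have "{e \<in> A. c \<in> e} = (\<lambda>v. {c, v}) ` {v. {c, v} \<in> A}"
    using assms by (fastforce simp: finite_simple_graph_def card_2_iff insert_commute)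
  moreover have "inj_on (\<lambda>v. {c, v}) {v. {c, v} \<in> A}"
    by (auto simp: inj_on_def doubleton_eq_iff)
  ultimately show ?thesis by (simp add: vertex_degree_def card_image)
qed

lemma vertex_degree_pos:
  assumes "finite_simple_graph V A" "connected_graph V A" "u \<in> V" "v \<in> V" "u \<noteq> v"
  shows "0 < vertex_degree A v"
proof -
  have "(v, u) \<in> {(x, y). {x, y} \<in> A}\<^sup>*" using assms by (auto simp: connected_graph_def)
  then obtain z where "{v, z} \<in> A" using assms(5) by (auto elim: converse_rtranclE)
  moreover have "finite A"
    using assms(1) finite_subset[of A "Pow V"] by (auto simp: finite_simple_graph_def)
  ultimately show ?thesis by (auto simp: vertex_degree_def card_gt_0_iff)
qed

text \<open>Replaces the head and tail of the sorted degree list by a vertex \<open>c\<close> of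
  maximal degree and the remaining vertices.\<close>

lemma stringiness_eq:
  assumes "finite V" "V \<noteq> {}"
  obtains c where "c \<in> V" "\<And>v. v \<in> V \<Longrightarrow> vertex_degree A v \<le> vertex_degree A c"
    "stringiness V A = (vertex_degree A c + 1) * (\<Prod>v\<in>V - {c}. vertex_degree A v)"
proof -
  define L where "L = degree_sequence V A"
  have mL: "mset L = image_mset (vertex_degree A) (mset_set V)"
    by (simp add: L_def degree_sequence_def)
  have sL: "sorted (rev L)" by (simp add: L_def degree_sequence_def)
  have setL: "set L = vertex_degree A ` V"
    using mL assms(1) by (metis finite_set_mset_mset_set set_image_mset set_mset_mset)
  then obtain a L' where L: "L = a # L'" using assms(2) by (cases L) auto
  have "a \<in> vertex_degree A ` V" unfolding setL[symmetric] L by simp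
  then obtain c where c: "c \<in> V" "vertex_degree A c = a" by blast
  have "mset_set V = add_mset c (mset_set (V - {c}))"
    using c(1) assms(1) by (metis mset_set.remove)
  hence "mset L' = image_mset (vertex_degree A) (mset_set (V - {c}))" using mL L c by simp
  hence "prod_list L' = (\<Prod>v\<in>V - {c}. vertex_degree A v)"
    by (metis prod_mset_prod_list prod_unfold_prod_mset)
  hence "stringiness V A = (vertex_degree A c + 1) * (\<Prod>v\<in>V - {c}. vertex_degree A v)"
    using L c(2) by (simp add: stringiness_def flip: L_def)
  moreover have "vertex_degree A v \<le> vertex_degree A c" if "v \<in> V" for v
  proof -
    have "vertex_degree A v \<in> set L" using setL that by auto
    thus ?thesis using sL L c(2) by (auto simp: sorted_append)
  qed
  ultimately show ?thesis using that c(1) by blast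
qed

section \<open>Comparing the embedding cost with the stringiness\<close>

text \<open>First- and second-order truncations of the expanded product. Twice the second elementary
  symmetric sum is the square of the sum minus the sum of squares, and the latter is at most
  \<open>q * sum a U\<close>. The first bound feeds the induction step of the second.\<close>

lemma prod_Suc_ge:
  fixes a :: "'b \<Rightarrow> nat"
  assumes "finite U" "\<And>i. i \<in> U \<Longrightarrow> a i \<le> q"
  shows "1 + sum a U \<le> (\<Prod>i\<in>U. Suc (a i))"
    and "2 + 2 * sum a U + (sum a U)\<^sup>2 \<le> 2 * (\<Prod>i\<in>U. Suc (a i)) + q * sum a U"
proof -
  have "1 + sum a U \<le> (\<Prod>i\<in>U. Suc (a i)) \<and>
    2 + 2 * sum a U + (sum a U)\<^sup>2 \<le> 2 * (\<Prod>i\<in>U. Suc (a i)) + q * sum a U"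
    using assms
  proof (induction)
    case (insert x F)
    let ?S = "sum a F" and ?P = "\<Prod>i\<in>F. Suc (a i)"
    have IH: "1 + ?S \<le> ?P" "2 + 2 * ?S + ?S\<^sup>2 \<le> 2 * ?P + q * ?S" using insert by auto
    have "a x * (1 + ?S) \<le> a x * ?P" using IH(1) by (rule mult_left_mono) simp
    hence le: "a x + a x * ?S \<le> a x * ?P" by simp
    have sq: "a x * a x \<le> q * a x" using insert.prems by simp
    have "1 + (a x + ?S) \<le> ?P + a x * ?P" using le IH(1) by linarith
    moreover have "2 + 2 * (a x + ?S) + (a x + ?S)\<^sup>2 \<le> 2 * (?P + a x * ?P) + q * (a x + ?S)"
    proof -
      have "2 + 2 * (a x + ?S) + (a x + ?S)\<^sup>2 = (2 + 2 * ?S + ?S\<^sup>2) + 2 * (a x + a x * ?S) + a x * a x"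
        by (simp add: power2_eq_square algebra_simps)
      also have "\<dots> \<le> (2 * ?P + q * ?S) + 2 * (a x * ?P) + q * a x"
        by (intro add_mono mult_le_mono2 IH(2) le sq)
      finally show ?thesis by (simp add: algebra_simps)
    qed
    ultimately show ?case using insert.hyps by simp
  qed simp
  thus "1 + sum a U \<le> (\<Prod>i\<in>U. Suc (a i))"
    "2 + 2 * sum a U + (sum a U)\<^sup>2 \<le> 2 * (\<Prod>i\<in>U. Suc (a i)) + q * sum a U" by auto
qed

text \<open>The cost is quadratic in the number \<open>s\<close> of leaves attached after the star.
  For \<open>S \<le> k\<close> the linear bound on \<open>P\<close> is enough; beyond that the
  quadratic one is needed.\<close>

lemma leaf_costs_less:
  fixes k s S P :: nat
  assumes "s \<le> S" "1 + S \<le> P" "2 + 2 * S + S\<^sup>2 \<le> 2 * P + (k - 1) * S"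
  shows "k + \<Sum>{k + 1..<k + s + 1} < 2 * ((k + 1) * P)"
proof -
  have "2 * \<Sum>{k + 1..<k + s + 1} = 2 * k * s + s * (s + 1)"
    by (induction s) (auto simp: algebra_simps)
  also have "\<dots> \<le> 2 * k * S + S * (S + 1)"
    using assms(1) by (intro add_mono mult_mono) auto
  finally have "2 * (k + \<Sum>{k + 1..<k + s + 1}) \<le> 2 * k + 2 * k * S + S * (S + 1)" by simp
  also have "\<dots> < 2 * (2 * ((k + 1) * P))"
  proof (cases "S \<le> k")
    case True
    hence "S * S \<le> k * S" by (rule mult_right_mono) simp
    moreover have "(k + 1) * (1 + S) \<le> (k + 1) * P" using assms(2) by (rule mult_left_mono) simp
    moreover have "(k + 1) * (1 + S) = k * S + k + S + 1" "S * (S + 1) = S * S + S"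
      by (simp_all add: algebra_simps)
    ultimately show ?thesis by linarith
  next
    case False
    then obtain u where u: "S = k + u" by (metis le_add_diff_inverse nat_le_linear)
    have "(k - 1) * S \<le> k * S" by simp
    hence "2 + 2 * S + S\<^sup>2 \<le> 2 * P + k * S" using assms(3) by linarith
    \<comment> \<open>With \<open>S = k + u\<close> the square is \<open>k * S + u * S\<close>, and
      \<open>k * S\<close> cancels.\<close>
    hence "2 + 2 * S + u * S \<le> 2 * P" by (simp add: u power2_eq_square algebra_simps)
    hence "2 * (k + 1) * (2 + 2 * S + u * S) \<le> 2 * (k + 1) * (2 * P)" by (rule mult_left_mono) simp
    moreover have "2 * k + 2 * k * S + S * (S + 1) < 2 * (k + 1) * (2 + 2 * S + u * S)"
      by (simp add: u algebra_simps)
    ultimately show ?thesis by (simp add: algebra_simps)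
  qed
  finally show ?thesis by (simp only: nat_mult_less_cancel_disj)
qed

text \<open>With \<open>a v\<close> one less than the degree, the degree sum is
  \<open>k + sum a U + card U\<close>. It is at least \<open>2 * card U\<close>, since a connected
  graph has at least \<open>card U\<close> edges; so \<open>sum a U\<close> bounds the number of
  vertices beyond the closed star.\<close>

lemma leaf_costs_less_stringiness:
  assumes G: "finite_simple_graph V A" "connected_graph V A"
    and c: "c \<in> V" "\<And>v. v \<in> V \<Longrightarrow> vertex_degree A v \<le> vertex_degree A c"
  shows "vertex_degree A c + \<Sum>{vertex_degree A c + 1..<card V} <
    2 * ((vertex_degree A c + 1) * (\<Prod>v\<in>V - {c}. vertex_degree A v))"
proof -
  define U where "U = V - {c}"
  define k where "k = vertex_degree A c"
  define a where "a v = vertex_degree A v - 1" for v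
  have fin: "finite V" "finite U" using G by (auto simp: finite_simple_graph_def U_def)
  have deg: "vertex_degree A v = Suc (a v)" if "v \<in> U" for v
    using that vertex_degree_pos[OF G c(1), of v] by (auto simp: a_def U_def)
  have prod: "(\<Prod>v\<in>U. vertex_degree A v) = (\<Prod>v\<in>U. Suc (a v))"
    using deg by (intro prod.cong) auto
  have "a v \<le> k - 1" if "v \<in> U" for v
    using that c(2)[of v] by (auto simp: a_def k_def U_def)
  note ge = prod_Suc_ge[OF fin(2) this]
  have "(\<Sum>v\<in>V. vertex_degree A v) = k + (\<Sum>v\<in>U. vertex_degree A v)"
    using fin(1) c(1) by (simp add: sum.remove k_def U_def)
  also have "(\<Sum>v\<in>U. vertex_degree A v) = (\<Sum>v\<in>U. Suc (a v))" using deg by (intro sum.cong) auto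
  also have "\<dots> = sum a U + card U" by (rule sum_Suc)
  finally have "2 * card A = k + sum a U + card U" using sum_vertex_degree[OF G(1)] by simp
  moreover have V: "card V = card U + 1" using card.remove[OF fin(1) c(1)] by (simp add: U_def)
  ultimately have "card U - k \<le> sum a U" using connected_graph_card_edges[OF G] by linarith
  from leaf_costs_less[OF this ge]
  have "k + \<Sum>{k + 1..<k + (card U - k) + 1} < 2 * ((k + 1) * (\<Prod>v\<in>U. vertex_degree A v))"
    by (simp only: prod)
  \<comment> \<open>If the subtraction truncates, both intervals are empty.\<close>
  moreover have "{k + 1..<card V} = {k + 1..<k + (card U - k) + 1}" using V by auto
  ultimately show ?thesis by (simp add: k_def U_def)
qed

section \<open>Embedding a tree\<close>

lemma (in bounded_independence) ex_tree_embedding: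
  assumes tree: "tree_graph V A" and wT: "\<And>e. e \<in> A \<Longrightarrow> w e \<in> T" and c: "c \<in> V"
    and E: "E \<subseteq> X" "finite E"
      "(vertex_degree A c + \<Sum>{vertex_degree A c + 1..<card V}) * \<alpha> < card E"
  shows "\<exists>f. graph_embedding V A w d E f"
proof -
  have G: "finite_simple_graph V A" "connected_graph V A" "\<nexists>p. graph_cycle A p"
    using tree by (auto simp: tree_graph_def)
  have fin: "finite V" "\<And>e. e \<in> A \<Longrightarrow> e \<subseteq> V" "\<And>e. e \<in> A \<Longrightarrow> card e = 2"
    using G(1) by (auto simp: finite_simple_graph_def)
  define k where "k = vertex_degree A c"
  \<comment> \<open>Cost of a subtree with \<open>n\<close> vertices: \<open>k\<close> for the star,
    then the current size, from \<open>k + 1\<close> to \<open>n - 1\<close>, for each further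
    leaf.\<close>
  define cost where "cost n = (k + \<Sum>{k + 1..<n}) * \<alpha>" for n
  define N where "N = {v. {c, v} \<in> A}"
  have "N \<subseteq> V" using fin(2) by (auto simp: N_def)
  moreover have "c \<notin> N" using fin(3)[of "{c}"] by (auto simp: N_def)
  ultimately have N: "N \<subseteq> V" "finite N" "c \<notin> N" using fin(1) finite_subset by auto
  have k: "k = card N" by (simp add: k_def N_def vertex_degree_eq_card_neighbours[OF G(1)])
  have cNV: "insert c N \<subseteq> V" using c N by simp
  \<comment> \<open>Connectedness is part of the invariant because it makes the next vertex a leaf.
    The set \<open>E\<close> is quantified because attaching a leaf applies the hypothesis to a
    smaller set.\<close>
  have "connected_graph V (induced_edges A V) \<and>
    (\<forall>E. E \<subseteq> X \<longrightarrow> finite E \<longrightarrow> cost (card V) < card E \<longrightarrow>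
      (\<exists>f. graph_embedding V (induced_edges A V) w d E f))"
    using fin(1) G(2) cNV insert_not_empty
  proof (induction rule: connected_graph_induct)
    case start
    \<comment> \<open>An edge between two neighbours of \<open>c\<close> would close a
      triangle.\<close>
    have star: "c \<in> e" if e: "e \<in> induced_edges A (insert c N)" for e
    proof (rule ccontr)
      assume "c \<notin> e"
      moreover have "card e = 2" using e fin(3) by blast
      then obtain u v where uv: "e = {u, v}" "u \<noteq> v" unfolding card_2_iff by blast
      ultimately have "graph_cycle A [c, u, v]"
        using e N by (auto simp: graph_cycle_def N_def insert_commute)
      thus False using G(3) by blast
    qed
    show ?case
    proof (intro conjI allI impI)
      let ?R = "{(x, y). {x, y} \<in> induced_edges A (insert c N)}"
      have "(x, c) \<in> ?R\<^sup>*" "(c, x) \<in> ?R\<^sup>*" if "x \<in> insert c N" for x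
        using that by (cases "x = c"; auto simp: N_def insert_commute intro!: r_into_rtrancl)+
      thus "connected_graph (insert c N) (induced_edges A (insert c N))"
        unfolding connected_graph_def by (blast intro: rtrancl_trans)
    next
      fix E assume E: "E \<subseteq> X" "finite E" "cost (card (insert c N)) < card E"
      show "\<exists>f. graph_embedding (insert c N) (induced_edges A (insert c N)) w d E f"
      proof (rule ex_star_embedding)
        show "card e = 2 \<and> c \<in> e \<and> w e \<in> T" if "e \<in> induced_edges A (insert c N)" for e
          using star[OF that] that fin(3) wT by blast
        show "N = {v. {c, v} \<in> induced_edges A (insert c N)}" by (auto simp: N_def)
        show "card N * \<alpha> < card E" using E(3) N k by (simp add: cost_def)
      qed (use N E in auto)
    qed
  next
    case (insert W u v)
    have W: "finite W" using insert(2) fin(1) by (rule finite_subset)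
    have conn: "connected_graph W (induced_edges A W)" using insert by blast
    have edges: "induced_edges A (insert v W) = insert {u, v} (induced_edges A W)"
    proof -
      have "e = {u, v}" if e: "e \<in> A" "e \<subseteq> insert v W" "v \<in> e" for e
      proof -
        obtain x y where "e = {x, y}" "x \<noteq> y" using fin(3)[OF e(1)] unfolding card_2_iff by blast
        then obtain z where z: "e = {z, v}" "z \<noteq> v" using e(3) by (cases "y = v") auto
        thus ?thesis using acyclic_unique_neighbour[OF G(3) conn insert(5,3), of z] e insert(6) by auto
      qed
      hence "induced_edges A (insert v W) \<subseteq> insert {u, v} (induced_edges A W)" by blast
      thus ?thesis using insert(3,6) by blast
    qed
    have "card (insert c N) \<le> card W" using insert(1) W by (rule card_mono[rotated])
    \<comment> \<open>Ensures that the sum in \<open>cost\<close> really gains the summand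
      \<open>card W\<close>.\<close>
    hence "k + 1 \<le> card W" using k N by simp
    hence cost: "cost (card (insert v W)) = cost (card W) + card W * \<alpha>"
      using W insert(5) by (simp add: cost_def algebra_simps)
    show ?case
    proof (intro conjI allI impI)
      show "connected_graph (insert v W) (induced_edges A (insert v W))"
        using conn insert(3,6) by (rule connected_graph_insert)
    next
      fix E assume E: "E \<subseteq> X" "finite E" "cost (card (insert v W)) < card E"
      show "\<exists>f. graph_embedding (insert v W) (induced_edges A (insert v W)) w d E f"
        unfolding edges
      proof (rule ex_embedding_insert_leaf)
        show "\<exists>f. graph_embedding W (induced_edges A W) w d E f"
          if "E \<subseteq> X" "finite E" "cost (card W) < card E" for E
          using insert(7) that by blast
      qed (use E W insert(3,5,6) wT cost in auto)
    qed
  qed (use fin N c in auto)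
  moreover have "induced_edges A V = A" using fin by auto
  ultimately show ?thesis using E by (simp add: cost_def k_def)
qed

section \<open>From K-surjectivity to the embedding\<close>

text \<open>An integer above \<open>\<lfloor>K\<rfloor>\<close> exceeds \<open>K \<ge> 1\<close>, so
  \<open>S\<close> has at least two points. If surjectivity only yields a diagonal pair,
  \<open>realised_off_diagonal\<close> supplies distinct points at the same distance.\<close>

lemma bounded_independence_if_K_surjective:
  assumes "symmetric_distance X D d" "1 \<le> K" "K_surjective X D d K"
    and "realised_off_diagonal X d K T" "T \<subseteq> D"
  shows "bounded_independence X d T (nat \<lfloor>K\<rfloor>)"
proof
  show "d x y = d y x" if "x \<in> X" "y \<in> X" for x y
    using assms(1) that by (auto simp: symmetric_distance_def)
next
  fix t S assume S: "t \<in> T" "S \<subseteq> X" "finite S" "nat \<lfloor>K\<rfloor> < card S"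
  hence "K < card S" using assms(2) by linarith
  hence large: "card_at_least S K" "card_at_least S 2"
    using assms(2) by (auto simp: card_at_least_def)
  hence "t \<in> (\<lambda>(x, y). d x y) ` (S \<times> S)" using assms S by (auto simp: K_surjective_def)
  then obtain x y where xy: "x \<in> S" "y \<in> S" "t = d x y" by auto
  show "\<exists>x\<in>S. \<exists>y\<in>S. x \<noteq> y \<and> d x y = t"
  proof (cases "x = y")
    case True
    thus ?thesis using assms(4) large S xy unfolding realised_off_diagonal_def by metis
  qed (use xy in auto)
qed

theorem corollary1p7:
  fixes X E :: "'a set" and D :: "'d set" and d :: "'a \<Rightarrow> 'a \<Rightarrow> 'd" and K :: real
    and V :: "'v set" and A :: "'v set set" and w :: "'v set \<Rightarrow> 'd"
  assumes "symmetric_distance X D d"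
    and "K \<ge> 1"
    and "K_surjective X D d K"
    and "E \<subseteq> X"
    and "weighted_tree V A w D"
    and "realised_off_diagonal X d K (w ` A)"
    and "card_at_least E (2 * real (stringiness V A) * K)"
  shows "\<exists>f. graph_embedding V A w d E f"
proof -
  let ?\<alpha> = "nat \<lfloor>K\<rfloor>"
  have "w ` A \<subseteq> D" and tree: "tree_graph V A" using assms(5) by (auto simp: weighted_tree_def)
  then interpret bounded_independence X d "w ` A" ?\<alpha>
    by (intro bounded_independence_if_K_surjective[OF assms(1-3,6)])
  have G: "finite_simple_graph V A" "connected_graph V A" "finite V" "V \<noteq> {}"
    using tree by (auto simp: tree_graph_def finite_simple_graph_def connected_graph_def)
  obtain c where c: "c \<in> V" "\<And>v. v \<in> V \<Longrightarrow> vertex_degree A v \<le> vertex_degree A c"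
    "stringiness V A = (vertex_degree A c + 1) * (\<Prod>v\<in>V - {c}. vertex_degree A v)"
    using stringiness_eq[OF G(3,4)] by blast
  define n where "n = vertex_degree A c + \<Sum>{vertex_degree A c + 1..<card V}"
  have "n < 2 * stringiness V A"
    unfolding n_def c(3) by (rule leaf_costs_less_stringiness[OF G(1,2) c(1,2)])
  \<comment> \<open>Positivity, from \<open>K \<ge> 1\<close>, keeps the inequality strict after
    multiplication.\<close>
  moreover have \<alpha>: "0 < ?\<alpha>" "real ?\<alpha> \<le> K" using assms(2) by linarith+
  ultimately have n: "n * ?\<alpha> < 2 * stringiness V A * ?\<alpha>" by simp
  \<comment> \<open>The embedding lemma counts points of a finite set, so an infinite
    \<open>E\<close> is cut down to a sufficiently large finite subset.\<close>
  obtain F where F: "F \<subseteq> E" "finite F" "n * ?\<alpha> < card F"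
  proof (cases "finite E")
    case True
    have "real (2 * stringiness V A * ?\<alpha>) \<le> 2 * real (stringiness V A) * K"
      using \<alpha>(2) by (simp add: mult_left_mono)
    also have "\<dots> \<le> card E" using assms(7) True by (simp add: card_at_least_def)
    finally have "2 * stringiness V A * ?\<alpha> \<le> card E" by (simp only: of_nat_le_iff)
    hence "n * ?\<alpha> < card E" using n by linarith
    thus ?thesis using True by (intro that[of E]) auto
  next
    case False
    then obtain F where "F \<subseteq> E" "finite F" "card F = Suc (n * ?\<alpha>)"
      using infinite_arbitrarily_large by blast
    thus ?thesis using that by simp
  qed
  then obtain f where "graph_embedding V A w d F f"
    using ex_tree_embedding[OF tree _ c(1), of w F] assms(4) by (auto simp: n_def)
  thus ?thesis using F(1) by (auto simp: graph_embedding_def)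
qed

end
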